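(* For every integer $d\ge 1$ and every even integer $\kappa\ge 2$, $$\boldsymbol{\theta}_{0,\kappa}(D) := \Big\{\prod_{q=1}^d \cos(j_q\pi/\kappa) : (j_1,\ldots,j_d)\in\{0,\ldots,\kappa\}^d\Big\} \subset \boldsymbol{\Theta}_{0,\kappa}(D).$$
   Context: $D=D[d]=\prod_{i=1}^d \frac12(S_i+S_i^* )$ is the Molchanov--Vainberg Laplacian on $\ell^2(\mathbb{Z}^d)$ ($S_i$ the unit shift in the $i$-th coordinate), with spectrum $\sigma(D)=[-1,1]$. Let $U_n$ be the Chebyshev polynomial of the second kind, $U_{n-1}(\cos\theta)=\sin(n\theta)/\sin\theta$. For $j\in\mathbb{N}^*=\{1,2,\ldots\}$ and $\vec{x}=(x_1,\ldots,x_d)\in[-1,1]^d$ let $g_{j\kappa}(\vec{x}) = \sum_{i=1}^d \big(\prod_{l\neq i}x_l\big)(1-x_i^2)U_{j\kappa-1}(x_i)$, and $S_E=\{\vec{x}\in[-1,1]^d:\prod_{l=1}^d x_l=E\}$. $\boldsymbol{\Theta}_{0,\kappa}(D)$ is the set of $E\in[-1,1]$ such that there is $\vec{x}\in S_E$ with $g_{j\kappa}(\vec{x})=0$ for all $j\in\mathbb{N}^*$. *)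

theory Defs
  imports Complex_Main "HOL-Library.FuncSet" "HOL-Computational_Algebra.Polynomial"
begin

fun cheb_U :: "nat \<Rightarrow> real poly" where
  "cheb_U 0 = 1"
| "cheb_U (Suc 0) = [:0, 2:]"
| "cheb_U (Suc (Suc n)) = [:0, 2:] * cheb_U (Suc n) - cheb_U n"

lemma cheb_U_cos_mult: "poly (cheb_U n) (cos t) * sin t = sin (real (Suc n) * t)"
proof (induction n rule: cheb_U.induct)
  case 1
  show ?case by simp
next
  case 2
  show ?case using sin_double[of t] by simp
next
  case (3 n)
  have "poly (cheb_U (Suc (Suc n))) (cos t) * sin t
      = 2 * cos t * (poly (cheb_U (Suc n)) (cos t) * sin t) - poly (cheb_U n) (cos t) * sin t"
    by (simp add: algebra_simps)
  also have "\<dots> = 2 * cos t * sin (real (Suc (Suc n)) * t) - sin (real (Suc n) * t)"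
    using 3 by simp
  also have "sin (real (Suc n) * t) = sin (real (Suc (Suc n)) * t - t)"
    by (simp add: algebra_simps)
  also have "2 * cos t * sin (real (Suc (Suc n)) * t) - sin (real (Suc (Suc n)) * t - t)
      = sin (real (Suc (Suc n)) * t + t)"
    by (simp only: sin_add sin_diff) (simp add: algebra_simps)
  also have "real (Suc (Suc n)) * t + t = real (Suc (Suc (Suc n))) * t"
    by (simp add: algebra_simps)
  finally show ?case .
qed

text \<open>The recursion above gives the Chebyshev polynomials of the second kind.\<close>

lemma cheb_U_cos:
  assumes "n \<ge> 1" and "sin t \<noteq> 0"
  shows "poly (cheb_U (n - 1)) (cos t) = sin (real n * t) / sin t"
  using cheb_U_cos_mult[of "n - 1" t] assms by (simp add: field_simps)

text \<open>A vector of length \<open>d\<close> is an extensional function on \<open>{1..d}\<close>.\<close>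

definition g :: "nat \<Rightarrow> nat \<Rightarrow> (nat \<Rightarrow> real) \<Rightarrow> real" where
  "g d m x = (\<Sum>i\<in>{1..d}. (\<Prod>l\<in>{1..d} - {i}. x l) * (1 - (x i)\<^sup>2) * poly (cheb_U (m - 1)) (x i))"

definition energy_surface :: "nat \<Rightarrow> real \<Rightarrow> (nat \<Rightarrow> real) set" where
  "energy_surface d E = {x \<in> {1..d} \<rightarrow>\<^sub>E {-1..1}. (\<Prod>l\<in>{1..d}. x l) = E}"

text \<open>The Molchanov--Vainberg Laplacian \<open>D\<close> enters \<open>Theta0\<close> only through its spectrum \<open>[-1, 1]\<close>
  and the level sets of its symbol \<open>\<Prod>l. x l\<close>.\<close>

definition Theta0 :: "nat \<Rightarrow> nat \<Rightarrow> real set" where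
  "Theta0 d \<kappa> = {E \<in> {-1..1}. \<exists>x \<in> energy_surface d E. \<forall>j\<ge>1. g d (j * \<kappa>) x = 0}"

definition theta0 :: "nat \<Rightarrow> nat \<Rightarrow> real set" where
  "theta0 d \<kappa> = {(\<Prod>q\<in>{1..d}. cos (real (j q) * pi / real \<kappa>)) |j. j \<in> {1..d} \<rightarrow>\<^sub>E {0..\<kappa>}}"

end

theory Submission
  imports Defs
begin

text \<open>The points \<open>cos (a * pi / \<kappa>)\<close> are the zeros of \<open>(1 - x\<^sup>2) * U\<^sub>\<kappa>\<^sub>-\<^sub>1 x\<close> in \<open>[-1, 1]\<close>, and they
  remain zeros when \<open>\<kappa>\<close> is replaced by a multiple \<open>j * \<kappa>\<close>. Hence, if all coordinates of a vector
  have this form, every summand of each \<open>g\<^sub>j\<^sub>\<kappa>\<close> vanishes separately, and the vector itself witnesses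
  that the product of its coordinates lies in \<open>Theta0 d \<kappa>\<close>.\<close>

text \<open>Writing \<open>1 - cos\<^sup>2 t = sin\<^sup>2 t\<close> lets one factor \<open>sin t\<close> cancel the denominator of
  \<open>sin (n * t) / sin t\<close>. The product form also covers the endpoints \<open>x = \<plusminus>1\<close>,
  where \<open>sin t = 0\<close> and the quotient is of no use.\<close>

lemma one_minus_cos_sq_cheb_U:
  assumes "n \<ge> 1"
  shows "(1 - (cos t)\<^sup>2) * poly (cheb_U (n - 1)) (cos t) = sin t * sin (real n * t)"
proof -
  have "(1 - (cos t)\<^sup>2) * poly (cheb_U (n - 1)) (cos t)
      = sin t * (poly (cheb_U (n - 1)) (cos t) * sin t)"
    unfolding sin_squared_eq[symmetric] by (simp add: power2_eq_square)
  also have "\<dots> = sin t * sin (real n * t)"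
    using assms cheb_U_cos_mult[of "n - 1" t] by simp
  finally show ?thesis .
qed

lemma one_minus_cos_sq_cheb_U_multiple_eq_0:
  assumes "\<kappa> \<ge> 1" and "j \<ge> 1"
  shows "(1 - (cos (real a * pi / real \<kappa>))\<^sup>2)
      * poly (cheb_U (j * \<kappa> - 1)) (cos (real a * pi / real \<kappa>)) = 0"
proof -
  have "real (j * \<kappa>) * (real a * pi / real \<kappa>) = real (j * a) * pi"
    using assms by simp
  then have "sin (real (j * \<kappa>) * (real a * pi / real \<kappa>)) = 0"
    by (simp only: sin_npi)
  then show ?thesis
    using assms by (subst one_minus_cos_sq_cheb_U) simp_all
qed

theorem lemma1p4:
  fixes d \<kappa> :: nat
  assumes "d \<ge> 1" and "\<kappa> \<ge> 2" and "even \<kappa>"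
  shows "theta0 d \<kappa> \<subseteq> Theta0 d \<kappa>"
proof
  fix E
  assume "E \<in> theta0 d \<kappa>"
  then obtain a where E: "E = (\<Prod>q\<in>{1..d}. cos (real (a q) * pi / real \<kappa>))"
    by (auto simp: theta0_def)
  define x where "x = restrict (\<lambda>q. cos (real (a q) * pi / real \<kappa>)) {1..d}"
  have "\<bar>E\<bar> \<le> 1"
    unfolding E abs_prod by (intro prod_le_1) auto
  moreover have "x \<in> energy_surface d E"
    by (auto simp: energy_surface_def x_def E)
  moreover have "g d (j * \<kappa>) x = 0" if "j \<ge> 1" for j
    unfolding g_def
  proof (rule sum.neutral, rule ballI)
    fix i
    assume "i \<in> {1..d}"
    then have "(1 - (x i)\<^sup>2) * poly (cheb_U (j * \<kappa> - 1)) (x i) = 0"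
      using one_minus_cos_sq_cheb_U_multiple_eq_0[of \<kappa> j "a i"] assms that
      by (simp add: x_def)
    then show "(\<Prod>l\<in>{1..d} - {i}. x l) * (1 - (x i)\<^sup>2) * poly (cheb_U (j * \<kappa> - 1)) (x i) = 0"
      by (simp only: mult.assoc mult_zero_right)
  qed
  ultimately show "E \<in> Theta0 d \<kappa>"
    by (auto simp: Theta0_def abs_le_iff)
qed

end
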